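(* Let $n\ge 2$, let $\alpha_1,\dots,\alpha_n>0$ be pairwise distinct, let $c>0$, let $X_1,\dots,X_n$ be independent with $X_i\sim \mathrm{Exp}(\alpha_i)$, and set $k=\frac1c$, $\lambda_i=\alpha_i^{c}$ and $Y_i=X_i^{-c}$. Then $Y_i\sim \mathrm{Frechet}(k,\lambda_i)$ for each $i$, and the Mixed Hypoexponential Frechet distribution $Z\sim MHF(k,\lambda_1,\dots,\lambda_n)$, i.e. the mixed T-G distribution generated from the hypoexponential distribution with parameters $(\alpha_1,\dots,\alpha_n)$ and the transformation $x\mapsto x^{-c}$, has PDF $$f_Z(t)=\sum_{i=1}^n\frac{1}{PF_i}f_{Y_i}(t),\qquad PF_i=\prod_{j=1,\,j\ne i}^{n}\left(1-\left(\frac{\lambda_i}{\lambda_j}\right)^{k}\right).$$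
   Context: $\mathrm{Exp}(\alpha)$ has density $\alpha e^{-\alpha t}$ for $t>0$. The hypoexponential distribution with pairwise distinct parameters $\alpha_1,\dots,\alpha_n>0$ is the law of $T=\sum_{i=1}^nX_i$ with $X_i\sim\mathrm{Exp}(\alpha_i)$ independent; its density is $f_{T}(t)=\sum_{i=1}^n\frac{f_{X_i}(t)}{P_i}$, $t>0$, where $P_i=\prod_{j\ne i}\left(1-\frac{\alpha_i}{\alpha_j}\right)$ (known fact). If a distribution $T$ has density $\sum_iA_if_{X_i}$ with $A_i\in\mathbb{R}$, $\sum_iA_i=1$, and $g$ is a one-to-one function, the mixed T-G distribution generated from $T$ and $g$ is the distribution with density $\sum_iA_if_{g(X_i)}$. $\mathrm{Frechet}(k,\lambda)$ with shape $k>0$ and scale $\lambda>0$ has density $\frac{k}{\lambda}\left(\frac{t}{\lambda}\right)^{-1-k}e^{-(t/\lambda)^{-k}}$ for $t>0$. *)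

theory Defs
  imports "HOL-Probability.Probability"
begin

text \<open>Nonnegativity of \<open>f\<close> is required separately because \<^const>\<open>ennreal\<close> truncates negative
  reals to 0, and \<open>f\<close> may be a linear combination with negative coefficients.\<close>

definition has_pdf :: "real measure \<Rightarrow> (real \<Rightarrow> real) \<Rightarrow> bool" where
  "has_pdf D f \<longleftrightarrow>
     prob_space D \<and> f \<in> borel_measurable borel \<and> (AE x in lborel. 0 \<le> f x) \<and>
     D = density lborel (\<lambda>x. ennreal (f x))"

definition frechet_density :: "real \<Rightarrow> real \<Rightarrow> real \<Rightarrow> real" where
  "frechet_density k l t =
     (if t \<le> 0 then 0
      else k / l * (t / l) powr (- 1 - k) * exp (- ((t / l) powr (- k))))"

text \<open>\<open>mixed_TG S T g Z\<close>: the law \<open>Z\<close> is a mixed T-G distribution generated from the law \<open>T\<close> and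
  the map \<open>g\<close>.  The laws \<open>P i\<close> are those of the components \<open>X\<^sub>i\<close>, with densities \<open>f i\<close>; the \<open>h i\<close>
  are densities of the \<open>g(X\<^sub>i)\<close>; the weights \<open>A i\<close> may be negative.  The set \<open>S\<close> carries all
  the components, and it is on \<open>S\<close> that \<open>g\<close> is one-to-one.  The decomposition of \<open>T\<close> is
  existentially quantified, so it is not built in that \<open>Z\<close> is determined by \<open>T\<close> and \<open>g\<close>.\<close>

definition mixed_TG ::
  "real set \<Rightarrow> real measure \<Rightarrow> (real \<Rightarrow> real) \<Rightarrow> real measure \<Rightarrow> bool" where
  "mixed_TG S T g Z \<longleftrightarrow>
     g \<in> borel_measurable borel \<and> inj_on g S \<and>
     (\<exists>(m::nat) (A::nat \<Rightarrow> real) (P::nat \<Rightarrow> real measure)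
        (f::nat \<Rightarrow> real \<Rightarrow> real) (h::nat \<Rightarrow> real \<Rightarrow> real).
        (\<forall>i\<in>{1..m}. has_pdf (P i) (f i) \<and> (AE x in P i. x \<in> S) \<and>
                    has_pdf (distr (P i) borel g) (h i)) \<and>
        (\<Sum>i\<in>{1..m}. A i) = 1 \<and>
        has_pdf T (\<lambda>t. \<Sum>i\<in>{1..m}. A i * f i t) \<and>
        has_pdf Z (\<lambda>t. \<Sum>i\<in>{1..m}. A i * h i t))"

end

theory Submission
  imports Defs
begin

text \<open>A real combination \<open>\<Sum>i. A i * h i\<close> of densities of laws \<open>Q i\<close> is a density of the probability
  law \<open>Z\<close> iff \<open>Z B = \<Sum>i. A i * Q i B\<close> for every Borel set \<open>B\<close>; nonnegativity of the combination comes
  for free from \<open>Z B \<ge> 0\<close>. The set-wise identity is preserved by images, so a mixed T-G law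
  generated from \<open>T\<close> and \<open>g\<close> can only be the image of \<open>T\<close> under \<open>g\<close>. It is also preserved by
  convolution, so the hypoexponential density follows by adding one exponential variable at a
  time; the weight of the new component is forced by the fact that the weights sum to 1, which is
  Lagrange interpolation of the constant 1 at the nodes \<open>\<alpha> i\<close>, evaluated at 0.\<close>

section \<open>Laws with a density and their signed mixtures\<close>

lemma has_pdf_prob_space: "has_pdf D f \<Longrightarrow> prob_space D"
  and has_pdf_sets: "has_pdf D f \<Longrightarrow> sets D = sets borel"
  by (auto simp: has_pdf_def)

lemma has_pdf_exponential:
  "0 < l \<Longrightarrow> has_pdf (density lborel (exponential_density l)) (exponential_density l)"
  by (auto simp: has_pdf_def prob_space_exponential_density)

lemma has_pdf_integral:
  assumes "has_pdf D f" "\<phi> \<in> borel_measurable borel"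
  shows "(\<integral>x. \<phi> x \<partial>D) = (\<integral>x. f x * \<phi> x \<partial>lborel)"
  using assms by (simp add: has_pdf_def integral_density)

lemma has_pdf_integrable:
  fixes \<phi> :: "real \<Rightarrow> real"
  assumes D: "has_pdf D f" and \<phi>: "\<phi> \<in> borel_measurable borel" "\<And>x. \<bar>\<phi> x\<bar> \<le> B"
  shows "integrable lborel (\<lambda>x. f x * \<phi> x)"
proof -
  interpret prob_space D using D by (rule has_pdf_prob_space)
  have "integrable D \<phi>"
    using \<phi> has_pdf_sets[OF D]
    by (intro integrable_const_bound[of _ B]) (auto cong: measurable_cong_sets)
  then show ?thesis
    using D \<phi> by (simp add: has_pdf_def integrable_density)
qed

lemma has_pdf_measure:
  assumes D: "has_pdf D f" and B: "B \<in> sets borel"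
  shows "measure D B = (\<integral>x. f x * indicator B x \<partial>lborel)"
  using has_pdf_integral[OF D, of "indicator B"] B has_pdf_sets[OF D]
  by (auto simp: has_pdf_def)

text \<open>The weights may be negative, so the sum has to be pulled out of a Bochner integral.
  Boundedness of \<open>\<phi>\<close> makes every \<open>h i * \<phi>\<close> integrable, which
  justifies this.\<close>

lemma integral_has_pdf_mixture:
  fixes \<phi> :: "real \<Rightarrow> real"
  assumes h: "\<And>i. i \<in> I \<Longrightarrow> has_pdf (Q i) (h i)"
    and Z: "has_pdf Z (\<lambda>t. \<Sum>i\<in>I. A i * h i t)"
    and \<phi>: "\<phi> \<in> borel_measurable borel" "\<And>x. \<bar>\<phi> x\<bar> \<le> B"
  shows "(\<integral>x. \<phi> x \<partial>Z) = (\<Sum>i\<in>I. A i * (\<integral>x. \<phi> x \<partial>Q i))"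
proof -
  have "(\<integral>x. \<phi> x \<partial>Z) = (\<integral>x. (\<Sum>i\<in>I. A i * (h i x * \<phi> x)) \<partial>lborel)"
    using has_pdf_integral[OF Z \<phi>(1)] by (simp add: sum_distrib_right mult.assoc)
  also have "\<dots> = (\<Sum>i\<in>I. A i * (\<integral>x. h i x * \<phi> x \<partial>lborel))"
    using has_pdf_integrable[OF h \<phi>] by (subst Bochner_Integration.integral_sum) auto
  finally show ?thesis
    using has_pdf_integral[OF h \<phi>(1)] by simp
qed

lemma measure_has_pdf_mixture:
  assumes "\<And>i. i \<in> I \<Longrightarrow> has_pdf (Q i) (h i)"
    and "has_pdf Z (\<lambda>t. \<Sum>i\<in>I. A i * h i t)" and "B \<in> sets borel"
  shows "measure Z B = (\<Sum>i\<in>I. A i * measure (Q i) B)"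
proof -
  have meas: "measure D B = (\<integral>x. indicator B x \<partial>D)" if "has_pdf D f" for D f
    using has_pdf_sets[OF that] sets_eq_imp_space_eq[OF has_pdf_sets[OF that]] by simp
  show ?thesis
    using integral_has_pdf_mixture[OF assms(1,2), of "indicator B" 1] assms(3)
    by (simp add: meas[OF assms(2)] meas[OF assms(1)] indicator_def)
qed

text \<open>Converse of \<open>measure_has_pdf_mixture\<close>, by which all densities of
  combinations below are obtained: it suffices to compute with measures of Borel sets.\<close>

lemma has_pdf_mixtureI:
  assumes h: "\<And>i. i \<in> I \<Longrightarrow> has_pdf (Q i) (h i)"
    and Z: "prob_space Z" "sets Z = sets borel"
    and meas: "\<And>B. B \<in> sets borel \<Longrightarrow> measure Z B = (\<Sum>i\<in>I. A i * measure (Q i) B)"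
  shows "has_pdf Z (\<lambda>t. \<Sum>i\<in>I. A i * h i t)"
proof -
  let ?s = "\<lambda>t. \<Sum>i\<in>I. A i * h i t"
  interpret prob_space Z by fact
  have int_h: "integrable lborel (\<lambda>x. h i x * indicator B x)"
    if "i \<in> I" "B \<in> sets borel" for i and B :: "real set"
    using has_pdf_integrable[OF h, of i "indicator B" 1] that by (auto simp: indicator_def[abs_def])
  have int_s: "integrable lborel ?s"
    using int_h[of _ UNIV] by auto
  have set_int: "(\<integral>x. indicator B x * ?s x \<partial>lborel) = measure Z B" if B: "B \<in> sets borel" for B
  proof -
    have "(\<integral>x. indicator B x * ?s x \<partial>lborel)
        = (\<integral>x. (\<Sum>i\<in>I. A i * (h i x * indicator B x)) \<partial>lborel)"
      by (simp add: sum_distrib_left mult_ac)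
    also have "\<dots> = (\<Sum>i\<in>I. A i * (\<integral>x. h i x * indicator B x \<partial>lborel))"
      using int_h[OF _ B] by (subst Bochner_Integration.integral_sum) auto
    finally show ?thesis
      using has_pdf_measure[OF h _] meas B by simp
  qed
  \<comment> \<open>An integrable function whose integral over every Borel set is nonnegative is
    nonnegative almost everywhere; here these integrals are the probabilities
    \<open>measure Z B\<close>. Hence \<open>ennreal\<close> truncates nothing outside a null
    set.\<close>
  have nonneg: "AE x in lborel. 0 \<le> ?s x"
    by (rule sigma_finite_measure.density_nonneg[OF sigma_finite_lborel int_s]) (use set_int in \<open>auto simp: set_lebesgue_integral_def\<close>)
  have "Z = density lborel (\<lambda>x. ennreal (?s x))"
  proof (rule measure_eqI)
    fix B assume "B \<in> sets Z"
    then have B: "B \<in> sets borel" using Z by simp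
    have nn: "(\<integral>\<^sup>+x. ennreal (indicator B x * ?s x) \<partial>lborel) = ennreal (\<integral>x. indicator B x * ?s x \<partial>lborel)"
      using nonneg B integrable_mult_indicator[OF _ int_s, of B]
      by (intro nn_integral_eq_integral) (auto split: split_indicator)
    have "emeasure Z B = ennreal (\<integral>x. indicator B x * ?s x \<partial>lborel)"
      unfolding set_int[OF B] emeasure_eq_measure ..
    also have "\<dots> = (\<integral>\<^sup>+x. ennreal (?s x) * indicator B x \<partial>lborel)"
      unfolding nn[symmetric] by (intro nn_integral_cong) (auto split: split_indicator)
    also have "\<dots> = emeasure (density lborel (\<lambda>x. ennreal (?s x))) B"
      using B borel_measurable_integrable[OF int_s] by (subst emeasure_density) auto
    finally show "emeasure Z B = emeasure (density lborel (\<lambda>x. ennreal (?s x))) B" .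
  qed (use Z in simp)
  then show ?thesis
    using Z nonneg borel_measurable_integrable[OF int_s] by (simp add: has_pdf_def)
qed

section \<open>Convolution of laws on the real line\<close>

lemma prob_space_convolution:
  fixes P Q :: "real measure"
  assumes "prob_space P" "prob_space Q" and [simp]: "sets P = sets borel" "sets Q = sets borel"
  shows "prob_space (P \<star> Q)"
proof -
  interpret P: prob_space P by fact
  interpret Q: prob_space Q by fact
  interpret PQ: pair_prob_space P Q ..
  have [measurable_cong]: "sets P = sets borel" "sets Q = sets borel" by fact+
  show ?thesis
    unfolding convolution_def by (intro PQ.P.prob_space_distr) measurable
qed

text \<open>Fubini, by conditioning on the first summand. The measurability claim is stated too
  because the integrand later serves as the test function \<open>\<phi>\<close> of
  \<open>integral_has_pdf_mixture\<close>.\<close>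

lemma measure_convolution:
  fixes P Q :: "real measure"
  assumes P: "prob_space P" "sets P = sets borel" and Q: "prob_space Q" "sets Q = sets borel"
    and B: "B \<in> sets borel"
  shows "measure (P \<star> Q) B = (\<integral>x. measure Q {y. y + x \<in> B} \<partial>P)"
    and "(\<lambda>x. measure Q {y. y + x \<in> B}) \<in> borel_measurable borel"
proof -
  interpret P: prob_space P by fact
  interpret Q: prob_space Q by fact
  have [measurable_cong]: "sets P = sets borel" "sets Q = sets borel" by fact+
  have [simp]: "space P = UNIV" "space Q = UNIV"
    using P Q by (auto dest: sets_eq_imp_space_eq)
  note [measurable] = B
  have "(\<lambda>x. emeasure Q (Pair x -` {z \<in> space (P \<Otimes>\<^sub>M Q). snd z + fst z \<in> B})) \<in> borel_measurable P"
    by (intro Q.measurable_emeasure_Pair) measurable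
  then have em: "(\<lambda>x. emeasure Q {y. y + x \<in> B}) \<in> borel_measurable borel"
    using P by (simp add: vimage_def space_pair_measure cong: measurable_cong_sets)
  then show meas: "(\<lambda>x. measure Q {y. y + x \<in> B}) \<in> borel_measurable borel"
    unfolding measure_def by measurable
  have "emeasure (P \<star> Q) B = (\<integral>\<^sup>+x. emeasure Q {y. y + x \<in> B} \<partial>P)"
    by (rule convolution_emeasure)
       (use P Q B in \<open>auto simp: P.finite_measure_axioms Q.finite_measure_axioms\<close>)
  also have "\<dots> = ennreal (\<integral>x. measure Q {y. y + x \<in> B} \<partial>P)"
    unfolding Q.emeasure_eq_measure
    by (intro nn_integral_eq_integral P.integrable_const_bound[of _ 1])
       (use meas P in \<open>auto cong: measurable_cong_sets\<close>)
  finally show "measure (P \<star> Q) B = (\<integral>x. measure Q {y. y + x \<in> B} \<partial>P)"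
    by (simp add: measure_def)
qed

text \<open>By conditioning on the left factor, the measure is the integral of one fixed function,
  bounded by 1, against \<open>Z\<close>; such integrals are linear in the mixture.\<close>

lemma measure_convolution_mixture:
  fixes R :: "real measure"
  assumes h: "\<And>i. i \<in> I \<Longrightarrow> has_pdf (Q i) (h i)"
    and Z: "has_pdf Z (\<lambda>t. \<Sum>i\<in>I. A i * h i t)"
    and R: "prob_space R" "sets R = sets borel" and B: "B \<in> sets borel"
  shows "measure (Z \<star> R) B = (\<Sum>i\<in>I. A i * measure (Q i \<star> R) B)"
proof -
  interpret R: prob_space R by fact
  note conv = measure_convolution[OF has_pdf_prob_space has_pdf_sets R B]
  have "measure (Z \<star> R) B = (\<integral>x. measure R {y. y + x \<in> B} \<partial>Z)"
    by (rule conv(1)[OF Z Z])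
  also have "\<dots> = (\<Sum>i\<in>I. A i * (\<integral>x. measure R {y. y + x \<in> B} \<partial>Q i))"
    by (rule integral_has_pdf_mixture[OF h Z conv(2)[OF Z Z], of 1]) auto
  also have "\<dots> = (\<Sum>i\<in>I. A i * measure (Q i \<star> R) B)"
    using conv(1)[OF h h] by simp
  finally show ?thesis .
qed

section \<open>Sums of independent exponential variables\<close>

text \<open>The case of two summands, by direct integration. Writing the result as a combination of
  the two original densities lets the induction step stay within mixtures of exponentials.\<close>

lemma has_pdf_convolution_exponential:
  fixes a b :: real
  assumes a: "0 < a" and b: "0 < b" and "a \<noteq> b"
  shows "has_pdf (density lborel (exponential_density a) \<star> density lborel (exponential_density b))
    (\<lambda>x. b / (b - a) * exponential_density a x + a / (a - b) * exponential_density b x)"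
proof -
  let ?E = "exponential_density" and ?D = "\<lambda>l. density lborel (exponential_density l)"
  let ?r = "\<lambda>x. b / (b - a) * ?E a x + a / (a - b) * ?E b x"
  have prob: "prob_space (?D a)" "prob_space (?D b)"
    using a b by (auto intro: prob_space_exponential_density)
  then have fin: "finite_measure (?D a)" "finite_measure (?D b)"
    by (auto intro: prob_space.finite_measure)
  \<comment> \<open>In this form the sign is visible: \<open>b - a\<close> and the difference of
    exponentials have the same sign for \<open>x \<ge> 0\<close>.\<close>
  have r_eq: "?r x = a * b / (b - a) * (exp (- a * x) - exp (- b * x))" if "0 \<le> x" for x
    using that \<open>a \<noteq> b\<close> by (simp add: exponential_density_def divide_simps) (simp add: algebra_simps)
  have r_nonneg: "0 \<le> ?r x" for x
  proof (cases "x < 0")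
    case False
    have "0 \<le> a * b / (b - a) * (exp (- a * x) - exp (- b * x))"
    proof (cases "a < b")
      case True
      have "a * x \<le> b * x" using True False by (intro mult_right_mono) auto
      then show ?thesis using True a b by auto
    next
      case False
      then have "b < a" using \<open>a \<noteq> b\<close> by simp
      moreover have "b * x \<le> a * x" using \<open>b < a\<close> \<open>\<not> x < 0\<close> by (intro mult_right_mono) auto
      ultimately show ?thesis using a b
        by (intro mult_nonpos_nonpos) (auto simp: divide_le_0_iff)
    qed
    then show ?thesis using r_eq[of x] False by simp
  qed (simp add: exponential_density_def)
  have nn: "(\<integral>\<^sup>+y. ennreal (?E a (x - y)) * ennreal (?E b y) \<partial>lborel) = ennreal (?r x)" for x
  proof (cases "x < 0")
    case True
    then have "(\<integral>\<^sup>+y. ennreal (?E a (x - y)) * ennreal (?E b y) \<partial>lborel) = (\<integral>\<^sup>+y. 0 \<partial>(lborel::real measure))"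
      by (intro nn_integral_cong) (auto simp: exponential_density_def)
    then show ?thesis using True by (simp add: exponential_density_def)
  next
    case False
    \<comment> \<open>The integrand vanishes off \<open>{0..x}\<close>, and the closed interval is
      exact because \<open>exponential_density\<close> is nonzero at 0. The exponent has slope
      \<open>a - b\<close> in \<open>y\<close>, whence the constant in the antiderivative
      \<open>?F\<close>.\<close>
    let ?f = "\<lambda>y. a * b * exp (- a * (x - y) - b * y)"
    let ?F = "\<lambda>y. - (a * b / (b - a)) * exp (- a * (x - y) - b * y)"
    have "(\<integral>\<^sup>+y. ennreal (?E a (x - y)) * ennreal (?E b y) \<partial>lborel)
        = (\<integral>\<^sup>+y. ennreal (?f y) * indicator {0..x} y \<partial>lborel)"
      using a b
      by (intro nn_integral_cong)
         (auto simp: exponential_density_def ennreal_mult[symmetric] exp_add[symmetric] algebra_simps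
               split: split_indicator)
    also have "\<dots> = ?F x - ?F 0"
    proof (rule nn_integral_FTC_Icc)
      show "(?F has_real_derivative ?f y) (at y)" for y
        using \<open>a \<noteq> b\<close> by (auto intro!: derivative_eq_intros simp: divide_simps) (simp add: algebra_simps)
    qed (use a b False in auto)
    also have "?F x - ?F 0 = ?r x"
      unfolding r_eq[OF False[unfolded not_less]] by (simp add: algebra_simps)
    finally show ?thesis .
  qed
  have "?D a \<star> ?D b = density lborel (\<lambda>x. ennreal (?r x))"
    by (subst convolution_density) (use fin nn in auto)
  then show ?thesis
    unfolding has_pdf_def using r_nonneg prob_space_convolution[OF prob] by auto
qed

text \<open>The \<open>?l i\<close> are the Lagrange basis polynomials for the nodes
  \<open>\<alpha> i\<close>. Their sum has degree below the number of nodes and equals 1 at each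
  node, so it is the constant 1.\<close>

lemma sum_inverse_prod_one_minus_ratio:
  fixes \<alpha> :: "'i \<Rightarrow> real"
  assumes I: "finite I" "I \<noteq> {}" and inj: "inj_on \<alpha> I" and nz: "\<And>i. i \<in> I \<Longrightarrow> \<alpha> i \<noteq> 0"
  shows "(\<Sum>i\<in>I. 1 / (\<Prod>j\<in>I - {i}. 1 - \<alpha> i / \<alpha> j)) = 1"
proof -
  let ?l = "\<lambda>i. \<Prod>j\<in>I - {i}. smult (1 / (\<alpha> i - \<alpha> j)) [:- \<alpha> j, 1:]"
  let ?p = "\<Sum>i\<in>I. ?l i"
  have poly_l: "poly (?l i) x = (\<Prod>j\<in>I - {i}. (x - \<alpha> j) / (\<alpha> i - \<alpha> j))" for i x
    by (simp add: poly_prod diff_divide_distrib)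
  have deg: "degree (?l i) < card I" if "i \<in> I" for i
  proof -
    have "degree (?l i) \<le> (\<Sum>j\<in>I - {i}. degree (smult (1 / (\<alpha> i - \<alpha> j)) [:- \<alpha> j, 1:]))"
      using degree_prod_sum_le[of "I - {i}" "\<lambda>j. smult (1 / (\<alpha> i - \<alpha> j)) [:- \<alpha> j, 1:]"] I
      unfolding o_def by blast
    also have "\<dots> \<le> (\<Sum>j\<in>I - {i}. 1)"
      by (intro sum_mono) (auto intro: order.trans[OF degree_smult_le])
    also have "\<dots> < card I" using that I by (simp add: card_gt_0_iff)
    finally show ?thesis .
  qed
  have "?p = 1"
  proof (rule poly_eqI_degree)
    fix x assume "x \<in> \<alpha> ` I"
    then obtain k where k: "k \<in> I" "x = \<alpha> k" by auto
    \<comment> \<open>At the node \<open>\<alpha> k\<close> every factor of \<open>?l k\<close> is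
      1, while each other \<open>?l i\<close> contains the vanishing factor
      \<open>j = k\<close>.\<close>
    have "poly ?p x = (\<Sum>i\<in>I. if i = k then 1 else 0)"
      unfolding poly_sum poly_l
    proof (rule sum.cong)
      fix i assume i: "i \<in> I"
      show "(\<Prod>j\<in>I - {i}. (x - \<alpha> j) / (\<alpha> i - \<alpha> j)) = (if i = k then 1 else 0)"
      proof (cases "i = k")
        case True
        then show ?thesis using k inj by (auto intro!: prod.neutral simp: inj_on_eq_iff split: if_splits)
      next
        case False
        then show ?thesis using k I by (auto intro!: prod_zero bexI[of _ k])
      qed
    qed simp
    then show "poly ?p x = poly 1 x" using k I by simp
  next
    have "card (\<alpha> ` I) = card I" using inj by (rule card_image)
    moreover have "0 < card I" using I by (simp add: card_gt_0_iff)
    ultimately show "degree ?p < card (\<alpha> ` I)" "degree (1 :: real poly) < card (\<alpha> ` I)"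
      using deg by (auto intro!: degree_sum_less)
  qed
  then have "poly ?p 0 = 1" by simp
  then have "(\<Sum>i\<in>I. \<Prod>j\<in>I - {i}. (0 - \<alpha> j) / (\<alpha> i - \<alpha> j)) = 1"
    by (simp add: poly_sum poly_prod)
  \<comment> \<open>At 0 each Lagrange factor is the reciprocal of the matching factor of the
    weight's denominator.\<close>
  moreover have "(\<Prod>j\<in>I - {i}. (0 - \<alpha> j) / (\<alpha> i - \<alpha> j)) = 1 / (\<Prod>j\<in>I - {i}. 1 - \<alpha> i / \<alpha> j)"
    if i: "i \<in> I" for i
  proof -
    have "(0 - \<alpha> j) / (\<alpha> i - \<alpha> j) = 1 / (1 - \<alpha> i / \<alpha> j)" if "j \<in> I - {i}" for j
    proof -
      have "\<alpha> i \<noteq> \<alpha> j" "\<alpha> j \<noteq> 0" using that i inj nz by (auto simp: inj_on_eq_iff)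
      then show ?thesis by (simp add: divide_simps) (simp add: algebra_simps)
    qed
    then show ?thesis by (simp add: prod_dividef)
  qed
  ultimately show ?thesis by simp
qed

text \<open>Induction on the index set. Convolving with the law of \<open>X b\<close> splits each
  old component into itself and the new exponential, by the case of two summands.\<close>

lemma has_pdf_hypoexponential:
  fixes X :: "'i \<Rightarrow> 'a \<Rightarrow> real"
  assumes M: "prob_space M" and I: "finite I" "I \<noteq> {}"
    and "inj_on \<alpha> I" "\<And>i. i \<in> I \<Longrightarrow> 0 < \<alpha> i"
    and "prob_space.indep_vars M (\<lambda>_. borel) X I"
    and "\<And>i. i \<in> I \<Longrightarrow> distributed M lborel (X i) (exponential_density (\<alpha> i))"
  shows "has_pdf (distr M borel (\<lambda>\<omega>. \<Sum>i\<in>I. X i \<omega>))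
    (\<lambda>t. \<Sum>i\<in>I. 1 / (\<Prod>j\<in>I - {i}. 1 - \<alpha> i / \<alpha> j) * exponential_density (\<alpha> i) t)"
  using I assms(4-)
proof (induction I rule: finite_ne_induct)
  case (singleton i)
  then have "distr M borel (X i) = density lborel (exponential_density (\<alpha> i))"
    using distributed_distr_eq_density[of M lborel "X i"] by (simp cong: distr_cong)
  then show ?case using has_pdf_exponential[of "\<alpha> i"] singleton by simp
next
  case (insert b I)
  interpret prob_space M by fact
  let ?D = "\<lambda>l. density lborel (exponential_density l)"
  let ?S = "distr M borel (\<lambda>\<omega>. \<Sum>i\<in>I. X i \<omega>)"
  let ?w = "\<lambda>J i. 1 / (\<Prod>j\<in>J - {i}. 1 - \<alpha> i / \<alpha> j)"
  have pos: "0 < \<alpha> i" if "i \<in> insert b I" for i using insert.prems that by auto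
  have meas_X[measurable]: "X i \<in> borel_measurable M" if "i \<in> insert b I" for i
    using distributed_measurable[OF insert.prems(4)[OF that]] by simp
  have IH: "has_pdf ?S (\<lambda>t. \<Sum>i\<in>I. ?w I i * exponential_density (\<alpha> i) t)"
    using insert.prems by (intro insert.IH) (auto intro: inj_on_subset indep_vars_subset)
  have "distr M borel (\<lambda>\<omega>. X b \<omega> + (\<Sum>i\<in>I. X i \<omega>)) = (distr M borel (X b) \<star> ?S)"
    using insert by (intro sum_indep_random_variable indep_vars_sum) auto
  also have "distr M borel (X b) = ?D (\<alpha> b)"
    using insert.prems distributed_distr_eq_density[of M lborel "X b"] by (simp cong: distr_cong)
  \<comment> \<open>The mixture has to be the left factor for
    \<open>measure_convolution_mixture\<close>.\<close>
  also have "(?D (\<alpha> b) \<star> ?S) = (?S \<star> ?D (\<alpha> b))"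
    using pos has_pdf_prob_space[OF IH]
    by (intro convolution_commutative)
       (auto intro!: prob_space.finite_measure prob_space_exponential_density)
  finally have T: "distr M borel (\<lambda>\<omega>. \<Sum>i\<in>insert b I. X i \<omega>) = (?S \<star> ?D (\<alpha> b))"
    using insert.hyps by simp
  have neq: "\<alpha> i \<noteq> \<alpha> b" if "i \<in> I" for i
    using that insert.prems(1) insert.hyps(3) inj_onD[of \<alpha> "insert b I" i b] by blast
  \<comment> \<open>Adding the index \<open>b\<close> puts just one more factor,
    \<open>1 - \<alpha> i / \<alpha> b\<close>, into the product for \<open>i\<close>.\<close>
  have w_step: "?w I i * (\<alpha> b / (\<alpha> b - \<alpha> i)) = ?w (insert b I) i" if "i \<in> I" for i
  proof -
    have "insert b I - {i} = insert b (I - {i})" using insert.hyps that by auto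
    moreover have "1 - \<alpha> i / \<alpha> b = (\<alpha> b - \<alpha> i) / \<alpha> b"
      using pos[of b] by (simp add: divide_simps)
    ultimately show ?thesis using insert.hyps by simp
  qed
  have total: "(\<Sum>i\<in>J. ?w J i) = 1" if "finite J" "J \<noteq> {}" "J \<subseteq> insert b I" for J
  proof (rule sum_inverse_prod_one_minus_ratio[OF that(1,2)])
    show "inj_on \<alpha> J" using insert.prems(1) that(3) by (rule inj_on_subset)
    show "\<alpha> i \<noteq> 0" if "i \<in> J" for i
      using pos[of i] that \<open>J \<subseteq> insert b I\<close> by auto
  qed
  \<comment> \<open>Both \<open>w\<close> families sum to 1, which determines the weight of the new component.\<close>
  have w_new: "(\<Sum>i\<in>I. ?w I i * (\<alpha> i / (\<alpha> i - \<alpha> b))) = ?w (insert b I) b"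
  proof -
    have "?w I i * (\<alpha> i / (\<alpha> i - \<alpha> b)) = ?w I i - ?w (insert b I) i" if "i \<in> I" for i
    proof -
      have "\<alpha> i / (\<alpha> i - \<alpha> b) = 1 - \<alpha> b / (\<alpha> b - \<alpha> i)"
        using neq[OF that] by (simp add: divide_simps) (simp add: algebra_simps)
      then show ?thesis
        unfolding w_step[OF that, symmetric] by (simp only: right_diff_distrib mult_1_right)
    qed
    then have "(\<Sum>i\<in>I. ?w I i * (\<alpha> i / (\<alpha> i - \<alpha> b))) = 1 - (\<Sum>i\<in>I. ?w (insert b I) i)"
      using total[OF insert.hyps(1,2) subset_insertI] by (simp add: sum_subtractf)
    then show ?thesis using total[of "insert b I"] insert.hyps by simp
  qed
  show ?case
  proof (rule has_pdf_mixtureI[of _ "\<lambda>i. ?D (\<alpha> i)"])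
    fix i assume "i \<in> insert b I"
    then show "has_pdf (?D (\<alpha> i)) (exponential_density (\<alpha> i))"
      by (intro has_pdf_exponential pos)
  next
    show "prob_space (distr M borel (\<lambda>\<omega>. \<Sum>i\<in>insert b I. X i \<omega>))"
      by (intro prob_space_distr) measurable
  next
    fix B :: "real set" assume B: "B \<in> sets borel"
    have two: "measure (?D (\<alpha> i) \<star> ?D (\<alpha> b)) B = \<alpha> b / (\<alpha> b - \<alpha> i) * measure (?D (\<alpha> i)) B
        + \<alpha> i / (\<alpha> i - \<alpha> b) * measure (?D (\<alpha> b)) B" if i: "i \<in> I" for i
    proof -
      \<comment> \<open>The two-term combination is indexed by \<open>bool\<close> to bring it into
        the shape of a mixture.\<close>
      have "has_pdf (?D (\<alpha> i) \<star> ?D (\<alpha> b)) (\<lambda>t. \<Sum>s\<in>{True, False}.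
          (if s then \<alpha> b / (\<alpha> b - \<alpha> i) else \<alpha> i / (\<alpha> i - \<alpha> b))
          * exponential_density (if s then \<alpha> i else \<alpha> b) t)"
        using has_pdf_convolution_exponential[of "\<alpha> i" "\<alpha> b"] pos neq i by simp
      from measure_has_pdf_mixture[OF _ this B, of "\<lambda>s. ?D (if s then \<alpha> i else \<alpha> b)"]
      show ?thesis using pos i by (simp add: has_pdf_exponential)
    qed
    have "measure (?S \<star> ?D (\<alpha> b)) B = (\<Sum>i\<in>I. ?w I i * measure (?D (\<alpha> i) \<star> ?D (\<alpha> b)) B)"
      by (rule measure_convolution_mixture[OF has_pdf_exponential IH _ _ B])
         (use pos in \<open>auto intro: prob_space_exponential_density\<close>)
    also have "\<dots> = (\<Sum>i\<in>I. ?w I i * (\<alpha> b / (\<alpha> b - \<alpha> i)) * measure (?D (\<alpha> i)) B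
        + ?w I i * (\<alpha> i / (\<alpha> i - \<alpha> b)) * measure (?D (\<alpha> b)) B)"
      by (intro sum.cong refl) (simp only: two distrib_left mult.assoc)
    \<comment> \<open>Each old component keeps the part given by \<open>w_step\<close>; the parts
      that go to the component \<open>b\<close> add up by \<open>w_new\<close>.\<close>
    also have "\<dots> = (\<Sum>i\<in>I. ?w (insert b I) i * measure (?D (\<alpha> i)) B)
        + ?w (insert b I) b * measure (?D (\<alpha> b)) B"
      unfolding sum.distrib w_new[symmetric] sum_distrib_right by (simp only: w_step cong: sum.cong)
    also have "\<dots> = (\<Sum>i\<in>insert b I. ?w (insert b I) i * measure (?D (\<alpha> i)) B)"
      using insert.hyps by simp
    finally show "measure (distr M borel (\<lambda>\<omega>. \<Sum>i\<in>insert b I. X i \<omega>)) B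
        = (\<Sum>i\<in>insert b I. ?w (insert b I) i * measure (?D (\<alpha> i)) B)"
      unfolding T .
  qed simp
qed

section \<open>The Frechet law as the image of an exponential law\<close>

lemma borel_measurable_frechet_density[measurable]: "frechet_density k l \<in> borel_measurable borel"
  unfolding frechet_density_def[abs_def] by measurable

lemma frechet_density_nonneg: "0 < k \<Longrightarrow> 0 < l \<Longrightarrow> 0 \<le> frechet_density k l t"
  by (simp add: frechet_density_def)

text \<open>The Frechet distribution function \<open>exp (- ((t / l) powr (- k)))\<close> is an
  antiderivative of the density on the positive axis and tends to 1 at infinity.\<close>

lemma emeasure_frechet_greaterThan:
  assumes k: "0 < k" and l: "0 < l" and x: "0 < x"
  shows "emeasure (density lborel (frechet_density k l)) {x<..} = 1 - exp (- ((x / l) powr (- k)))"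
proof -
  let ?F = "\<lambda>t. exp (- ((t / l) powr (- k)))"
  have "emeasure (density lborel (frechet_density k l)) {x<..}
      = (\<integral>\<^sup>+t. ennreal (frechet_density k l t) * indicator {x..} t \<partial>lborel)"
    \<comment> \<open>The endpoint is a null set; it is added because the fundamental theorem is
      applied on a closed half-line.\<close>
    using AE_lborel_singleton[of x]
    by (subst emeasure_density)
       (auto intro!: nn_integral_cong_AE elim!: eventually_mono split: split_indicator)
  also have "\<dots> = 1 - ?F x"
  proof (rule nn_integral_FTC_atLeast)
    fix t assume "x \<le> t"
    with x have t: "0 < t" by simp
    have "((\<lambda>t. (t / l) powr (- k)) has_real_derivative - k * (t / l) powr (- k - 1) * (1 / l)) (at t)"
      using t l by (intro DERIV_chain2[OF has_real_derivative_powr] DERIV_cdivide DERIV_ident) simp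
    from DERIV_chain2[OF DERIV_exp DERIV_minus[OF this]]
    show "(?F has_real_derivative frechet_density k l t) (at t)"
      using t by (simp add: frechet_density_def minus_diff_commute[of k 1] mult_ac)
  next
    have "filterlim (\<lambda>t. 1 / l * t) at_top at_top"
      using l by (intro filterlim_tendsto_pos_mult_at_top[OF tendsto_const _ filterlim_ident]) simp
    then have "((\<lambda>t. (t / l) powr (- k)) \<longlongrightarrow> 0) at_top"
      using k by (intro tendsto_neg_powr) simp_all
    from tendsto_exp[OF tendsto_minus[OF this]] show "(?F \<longlongrightarrow> 1) at_top" by simp
  qed (use k l in \<open>auto simp: frechet_density_nonneg\<close>)
  finally show ?thesis by simp
qed

lemma AE_exponential_pos: "AE x in density lborel (exponential_density l). 0 < x"
  using AE_lborel_singleton[of 0]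
  by (subst AE_density) (auto elim!: eventually_mono simp: exponential_density_def split: if_splits)

text \<open>The map is decreasing on the positive axis, so upper tails of the image are lower tails
  of the exponential law, whose distribution function is explicit. Tails determine the law.\<close>

lemma distr_exponential_powr:
  assumes a: "0 < a" and c: "0 < c"
  shows "distr (density lborel (exponential_density a)) borel (\<lambda>x. x powr (- c))
    = density lborel (frechet_density (1 / c) (a powr c))" (is "?M = ?N")
proof -
  let ?E = "density lborel (exponential_density a)"
  let ?g = "\<lambda>x::real. x powr (- c)"
  interpret E: prob_space ?E using a by (rule prob_space_exponential_density)
  interpret D: prob_space ?M by (intro E.prob_space_distr) simp
  have pos_eq: "emeasure ?M {x<..} = emeasure ?N {x<..}" if x: "0 < x" for x
  proof -
    \<comment> \<open>\<open>?y\<close> is the positive solution of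
      \<open>t powr (- c) = x\<close>.\<close>
    let ?y = "x powr (- 1 / c)"
    have iff: "x < t powr (- c) \<longleftrightarrow> t < ?y" if "0 < t" for t
    proof -
      have "x < t powr (- c) \<longleftrightarrow> ln x < - c * ln t"
        using that x by (subst ln_less_cancel_iff[symmetric]) (auto simp: ln_powr)
      also have "\<dots> \<longleftrightarrow> ln t < - 1 / c * ln x"
        using c by (auto simp: field_simps)
      also have "\<dots> \<longleftrightarrow> t < ?y"
        using that x by (subst (2) ln_less_cancel_iff[symmetric]) (auto simp: ln_powr)
      finally show ?thesis .
    qed
    have "emeasure ?M {x<..} = emeasure ?E {t. x < t powr (- c)}"
      by (subst emeasure_distr) (auto intro!: arg_cong[where f="emeasure ?E"])
    \<comment> \<open>For positive \<open>t\<close> the two sets differ only at \<open>?y\<close>,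
      and the nonpositive axis is null, so the values of \<open>powr\<close> there do not
      matter.\<close>
    also have "\<dots> = emeasure ?E {..?y}"
    proof (rule emeasure_eq_AE)
      have "AE t in ?E. t \<noteq> ?y"
        using AE_lborel_singleton[of ?y] by (subst AE_density) (auto elim!: eventually_mono)
      then show "AE t in ?E. t \<in> {t. x < t powr (- c)} \<longleftrightarrow> t \<in> {..?y}"
        using AE_exponential_pos[of a] by eventually_elim (simp add: iff, linarith)
    qed simp_all
    also have "\<dots> = ennreal (measure ?E {t\<in>space ?E. t \<le> ?y})"
      unfolding E.emeasure_eq_measure by (simp add: atMost_def)
    also have "measure ?E {t\<in>space ?E. t \<le> ?y} = 1 - exp (- ?y * a)"
    proof (rule E.exponential_distributedD_le)
      show "distributed ?E lborel (\<lambda>t. t) (exponential_density a)"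
        unfolding distributed_def by (auto intro!: distr_id2)
    qed (use a in simp_all)
    \<comment> \<open>Absorbing the rate \<open>a\<close> into the power produces the scale
      \<open>a powr c\<close> and the shape \<open>1 / c\<close>.\<close>
    also have "- ?y * a = - ((x / a powr c) powr (- (1 / c)))"
      using a c x by (simp add: powr_divide powr_powr powr_minus divide_simps)
    finally show ?thesis using emeasure_frechet_greaterThan[of "1 / c" "a powr c" x] a c x by simp
  qed
  \<comment> \<open>Continuity from below carries the equality of tails from positive thresholds to
    the threshold 0. Negative thresholds give the same value, as both laws live on the positive
    axis.\<close>
  have emeasure_pos: "emeasure L {0<..} = (SUP n. emeasure L {1 / real (Suc n)<..})"
    if "sets L = sets borel" for L :: "real measure"
  proof -
    have "(\<Union>n. {1 / real (Suc n)<..}) = {0::real<..}"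
    proof (intro equalityI subsetI)
      fix x :: real assume "x \<in> {0<..}"
      then obtain n where "inverse (real (Suc n)) < x" using reals_Archimedean[of x] by auto
      then show "x \<in> (\<Union>n. {1 / real (Suc n)<..})" by (auto simp: inverse_eq_divide)
    next
      fix x :: real assume "x \<in> (\<Union>n. {1 / real (Suc n)<..})"
      then obtain n where "1 / real (Suc n) < x" by auto
      moreover have "0 < 1 / real (Suc n)" by simp
      ultimately show "x \<in> {0<..}" unfolding greaterThan_iff by (rule less_trans[rotated])
    qed
    moreover have "incseq (\<lambda>n. {1 / real (Suc n)<..})"
      by (intro monoI) (auto intro!: frac_le elim!: le_less_trans[rotated])
    ultimately show ?thesis
      using that by (subst SUP_emeasure_incseq) auto
  qed
  have zero_eq: "emeasure ?M {0<..} = emeasure ?N {0<..}"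
    by (subst (1 2) emeasure_pos) (auto simp: pos_eq)
  have nonpos: "emeasure L {x<..} = emeasure L {0<..}"
    if "x \<le> 0" "sets L = sets borel" "AE t in L. 0 < t" for x and L :: "real measure"
    using that by (intro emeasure_eq_AE) (auto elim: eventually_mono)
  have AE_M: "AE t in ?M. 0 < t"
  proof -
    show ?thesis
      using AE_exponential_pos[of a] by (subst AE_distr_iff) (auto elim: eventually_mono)
  qed
  have AE_N: "AE t in ?N. 0 < t"
    by (subst AE_density) (auto simp: frechet_density_def)
  show ?thesis
  proof (rule measure_eqI_lessThan)
    fix x :: real
    show "emeasure ?M {x<..} < \<infinity>"
      by (simp add: D.emeasure_eq_measure)
    show "emeasure ?M {x<..} = emeasure ?N {x<..}"
      using pos_eq[of x] nonpos[of x, OF _ _ AE_M] nonpos[of x, OF _ _ AE_N] zero_eq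
      by (cases "0 < x") auto
  qed auto
qed

text \<open>Total mass 1 is inherited from the exponential law through the image map.\<close>

lemma has_pdf_frechet:
  assumes "0 < a" "0 < c"
  shows "has_pdf (density lborel (frechet_density (1 / c) (a powr c)))
    (frechet_density (1 / c) (a powr c))"
  unfolding has_pdf_def
proof (intro conjI)
  interpret prob_space "density lborel (exponential_density a)"
    using assms(1) by (rule prob_space_exponential_density)
  show "prob_space (density lborel (frechet_density (1 / c) (a powr c)))"
    unfolding distr_exponential_powr[OF assms, symmetric] by (intro prob_space_distr) simp
qed (use assms in \<open>auto simp: frechet_density_nonneg\<close>)

section \<open>Mixed T-G laws as images\<close>

lemma has_pdf_distr_mixture:
  assumes f: "\<And>i. i \<in> I \<Longrightarrow> has_pdf (P i) (f i)"
    and h: "\<And>i. i \<in> I \<Longrightarrow> has_pdf (distr (P i) borel g) (h i)"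
    and T: "has_pdf T (\<lambda>t. \<Sum>i\<in>I. A i * f i t)" and g: "g \<in> borel_measurable borel"
  shows "has_pdf (distr T borel g) (\<lambda>t. \<Sum>i\<in>I. A i * h i t)"
proof (rule has_pdf_mixtureI[OF h])
  have g': "g \<in> borel_measurable D" "space D = UNIV" if "sets D = sets borel" for D :: "real measure"
    using g that by (auto cong: measurable_cong_sets dest: sets_eq_imp_space_eq)
  note gT = g'[OF has_pdf_sets[OF T]]
  show "prob_space (distr T borel g)"
    using has_pdf_prob_space[OF T] gT(1) by (rule prob_space.prob_space_distr)
  fix B :: "real set" assume B: "B \<in> sets borel"
  then have "g -` B \<in> sets borel" using measurable_sets[OF g B] by simp
  from measure_has_pdf_mixture[OF f T this]
  show "measure (distr T borel g) B = (\<Sum>i\<in>I. A i * measure (distr (P i) borel g) B)"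
    using B g' has_pdf_sets[OF f] gT by (simp add: measure_distr)
qed simp_all

text \<open>Whatever decomposition of \<open>T\<close> is chosen, \<open>Z\<close> and the image of
  \<open>T\<close> share the density built from the \<open>h i\<close>. This gives uniqueness
  although the decomposition is only existentially quantified.\<close>

lemma mixed_TG_imp_distr:
  assumes "mixed_TG S T g Z"
  shows "Z = distr T borel g"
proof -
  from assms obtain m :: nat and A P f h where
    g: "g \<in> borel_measurable borel"
    and f: "\<And>i. i \<in> {1..m} \<Longrightarrow> has_pdf (P i) (f i)"
    and h: "\<And>i. i \<in> {1..m} \<Longrightarrow> has_pdf (distr (P i) borel g) (h i)"
    and T: "has_pdf T (\<lambda>t. \<Sum>i\<in>{1..m}. A i * f i t)"
    and Z: "has_pdf Z (\<lambda>t. \<Sum>i\<in>{1..m}. A i * h i t)"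
    unfolding mixed_TG_def by blast
  show ?thesis
    using has_pdf_distr_mixture[OF f h T g] Z by (simp add: has_pdf_def)
qed

section \<open>The mixed hypoexponential Frechet law\<close>

theorem theorem10:
  fixes M :: "'a measure" and n :: nat and \<alpha> lam PF :: "nat \<Rightarrow> real" and c k :: real
    and X Y :: "nat \<Rightarrow> 'a \<Rightarrow> real"
  assumes "prob_space M"
    and "n \<ge> 2"
    and "\<And>i. i \<in> {1..n} \<Longrightarrow> \<alpha> i > 0"
    and "inj_on \<alpha> {1..n}"
    and "c > 0"
    and "prob_space.indep_vars M (\<lambda>_. borel) X {1..n}"
    and "\<And>i. i \<in> {1..n} \<Longrightarrow> distributed M lborel (X i) (exponential_density (\<alpha> i))"
    and "k = 1 / c"
    and "\<And>i. i \<in> {1..n} \<Longrightarrow> lam i = \<alpha> i powr c"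
    and "\<And>i. i \<in> {1..n} \<Longrightarrow> Y i = (\<lambda>\<omega>. X i \<omega> powr (- c))"
    and "\<And>i. i \<in> {1..n} \<Longrightarrow> PF i = (\<Prod>j\<in>{1..n} - {i}. (1 - (lam i / lam j) powr k))"
  shows "(\<forall>i\<in>{1..n}. distributed M lborel (Y i) (frechet_density k (lam i))) \<and>
    (\<exists>!Z. mixed_TG {0<..} (distr M borel (\<lambda>\<omega>. \<Sum>i\<in>{1..n}. X i \<omega>)) (\<lambda>x. x powr (- c)) Z) \<and>
    (\<forall>Z. mixed_TG {0<..} (distr M borel (\<lambda>\<omega>. \<Sum>i\<in>{1..n}. X i \<omega>)) (\<lambda>x. x powr (- c)) Z \<longrightarrow>
         has_pdf Z (\<lambda>t. \<Sum>i\<in>{1..n}. 1 / PF i * frechet_density k (lam i) t))"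
proof -
  let ?I = "{1..n}"
  let ?g = "\<lambda>x::real. x powr (- c)"
  let ?T = "distr M borel (\<lambda>\<omega>. \<Sum>i\<in>?I. X i \<omega>)"
  let ?D = "\<lambda>i. density lborel (exponential_density (\<alpha> i))"
  let ?Z = "distr ?T borel ?g"
  note pos = assms(3) and lam = assms(9)
  have I: "finite ?I" "?I \<noteq> {}" using assms(2) by auto
  have Fr: "distr (?D i) borel ?g = density lborel (frechet_density k (lam i))" if "i \<in> ?I" for i
    using distr_exponential_powr[OF pos[OF that] assms(5)] lam[OF that] assms(8) by simp
  \<comment> \<open>Since \<open>c * k = 1\<close>, the power \<open>k\<close> turns the ratio of
    scales back into the ratio of rates, so \<open>1 / PF i\<close> is the hypoexponential
    weight.\<close>
  have PF: "PF i = (\<Prod>j\<in>?I - {i}. 1 - \<alpha> i / \<alpha> j)" if "i \<in> ?I" for i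
    unfolding assms(11)[OF that]
  proof (rule prod.cong)
    fix j assume "j \<in> ?I - {i}"
    then have "0 < \<alpha> i" "0 < \<alpha> j" "lam i = \<alpha> i powr c" "lam j = \<alpha> j powr c"
      using pos lam that by auto
    then show "1 - (lam i / lam j) powr k = 1 - \<alpha> i / \<alpha> j"
      using assms(5,8) by (simp add: powr_divide powr_powr)
  qed simp
  have g: "?g \<in> borel_measurable borel" by measurable
  have inj: "inj_on ?g {0<..}"
  proof (rule inj_onI)
    fix x y :: real assume "x \<in> {0<..}" "y \<in> {0<..}" "x powr (- c) = y powr (- c)"
    then have "(x powr (- c)) powr (- k) = (y powr (- c)) powr (- k)" "0 < x" "0 < y" by auto
    then show "x = y" using assms(5,8) by (simp add: powr_powr)
  qed
  have D: "has_pdf (?D i) (exponential_density (\<alpha> i))" if "i \<in> ?I" for i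
    using pos[OF that] by (rule has_pdf_exponential)
  have F: "has_pdf (distr (?D i) borel ?g) (frechet_density k (lam i))" if "i \<in> ?I" for i
    unfolding Fr[OF that] using has_pdf_frechet[OF pos[OF that] assms(5)] lam[OF that] assms(8) by simp
  have T: "has_pdf ?T (\<lambda>t. \<Sum>i\<in>?I. 1 / PF i * exponential_density (\<alpha> i) t)"
    using has_pdf_hypoexponential[OF assms(1) I assms(4,3,6,7)] by (simp only: PF cong: sum.cong)
  have Z: "has_pdf ?Z (\<lambda>t. \<Sum>i\<in>?I. 1 / PF i * frechet_density k (lam i) t)"
    by (rule has_pdf_distr_mixture[OF D F T g])
  have supp: "AE x in ?D i. x \<in> {0<..}" for i
    using AE_exponential_pos by simp
  have "(\<Sum>i\<in>?I. 1 / (\<Prod>j\<in>?I - {i}. 1 - \<alpha> i / \<alpha> j)) = 1"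
    by (rule sum_inverse_prod_one_minus_ratio[OF I assms(4)]) (use pos in force)
  then have one: "(\<Sum>i\<in>?I. 1 / PF i) = 1" by (simp only: PF cong: sum.cong)
  \<comment> \<open>Existence: the image law \<open>?Z\<close>, with exponential components and the
    weights \<open>1 / PF i\<close>.\<close>
  have mixed: "mixed_TG {0<..} ?T ?g ?Z"
    unfolding mixed_TG_def
    by (intro conjI exI[of _ n] exI[of _ "\<lambda>i. 1 / PF i"] exI[of _ ?D]
          exI[of _ "\<lambda>i. exponential_density (\<alpha> i)"] exI[of _ "\<lambda>i. frechet_density k (lam i)"] ballI
          g inj D F T Z supp one)
  have "distributed M lborel (Y i) (frechet_density k (lam i))" if i: "i \<in> ?I" for i
  proof -
    have X: "X i \<in> borel_measurable M"
      using distributed_measurable[OF assms(7)[OF i]] by simp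
    have "distr M borel (Y i) = distr (distr M lborel (X i)) borel ?g"
      unfolding assms(10)[OF i] using X by (subst distr_distr) (auto simp: o_def)
    also have "\<dots> = density lborel (frechet_density k (lam i))"
      using Fr[OF i] distributed_distr_eq_density[OF assms(7)[OF i]] by simp
    finally show ?thesis
      unfolding distributed_def assms(10)[OF i] using X by (auto cong: distr_cong)
  qed
  \<comment> \<open>Every admissible \<open>Z\<close> equals \<open>?Z\<close>, so uniqueness and
    the density of \<open>Z\<close> follow together.\<close>
  then show ?thesis
    using mixed Z mixed_TG_imp_distr by blast
qed

end
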